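(* Let $X$ be a complex Banach space with open unit ball $\mathbb{B}$, let $f:\mathbb{B}\to\mathbb{C}$ be holomorphic, and let $F:\mathbb{B}\to X$ be given by $F(x)=f(x)x$. For each $u\in\partial\mathbb{B}$ put $f_u(\zeta)=\zeta f(\zeta u)$, $|\zeta|<1$. Let $r\in(0,1)$ be fixed. Then $F$ is a starlike mapping on $B_r$ if and only if $f_u$ is starlike on $\mathbb{U}_r$ for all $u\in\partial\mathbb{B}$.
   Context: $B_r=\{x\in X:\|x\|<r\}$, $\mathbb{U}_r=\{\zeta\in\mathbb{C}:|\zeta|<r\}$, $\partial\mathbb{B}=\{x\in X:\|x\|=1\}$. A holomorphic mapping $F$ on a domain $D\subset X$ is biholomorphic on $D$ if it is injective on $D$, $F(D)$ is open, and the inverse $F(D)\to D$ is holomorphic. A holomorphic mapping $F$ is starlike on $B_r$ if $F$ is biholomorphic on $B_r$ and $F(B_r)$ is a starlike domain with respect to the origin. Starlikeness of $f_u$ on $\mathbb{U}_r$ is the case $X=\mathbb{C}$ of this definition: $f_u$ is univalent on $\mathbb{U}_r$ and $f_u(\mathbb{U}_r)$ is starlike with respect to $0$. *)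

theory Defs
  imports "HOL-Complex_Analysis.Complex_Analysis"
begin

text \<open>
  A complex Banach space carries a complex scalar multiplication that extends the real one of
  \<^class>\<open>banach\<close>, so balls, topology and Frechet derivatives are those of the library.
\<close>

class complex_vector = real_vector +
  fixes scaleC :: "complex \<Rightarrow> 'a \<Rightarrow> 'a"  (infixr \<open>*\<^sub>C\<close> 75)
  assumes scaleC_add_right: "a *\<^sub>C (x + y) = a *\<^sub>C x + a *\<^sub>C y"
    and scaleC_add_left: "(a + b) *\<^sub>C x = a *\<^sub>C x + b *\<^sub>C x"
    and scaleC_scaleC: "a *\<^sub>C b *\<^sub>C x = (a * b) *\<^sub>C x"
    and scaleC_one: "1 *\<^sub>C x = x"
    and scaleR_scaleC: "scaleR c x = complex_of_real c *\<^sub>C x"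

class complex_normed_vector = complex_vector + real_normed_vector +
  assumes norm_scaleC: "norm (a *\<^sub>C x) = cmod a * norm x"

class cbanach = complex_normed_vector + banach

instantiation complex :: cbanach
begin

definition scaleC_complex :: "complex \<Rightarrow> complex \<Rightarrow> complex"
  where "scaleC_complex a z = a * z"

instance
  by standard
    (simp_all add: scaleC_complex_def algebra_simps norm_mult scaleR_conv_of_real)

end

text \<open>
  Holomorphy is complex Frechet differentiability: \<^const>\<open>has_derivative\<close> supplies a bounded
  real-linear derivative, which is required to be complex-linear.
\<close>

definition holomorphic_map_on ::
    "('a::complex_normed_vector \<Rightarrow> 'b::complex_normed_vector) \<Rightarrow> 'a set \<Rightarrow> bool"
  where "holomorphic_map_on F D \<longleftrightarrow> open D \<and>
    (\<forall>x\<in>D. \<exists>L. (F has_derivative L) (at x) \<and> (\<forall>c h. L (c *\<^sub>C h) = c *\<^sub>C L h))"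

definition is_domain :: "'a::topological_space set \<Rightarrow> bool"
  where "is_domain D \<longleftrightarrow> open D \<and> connected D \<and> D \<noteq> {}"

definition biholomorphic_map_on ::
    "('a::complex_normed_vector \<Rightarrow> 'b::complex_normed_vector) \<Rightarrow> 'a set \<Rightarrow> bool"
  where "biholomorphic_map_on F D \<longleftrightarrow>
    is_domain D \<and> holomorphic_map_on F D \<and> inj_on F D \<and> open (F ` D) \<and>
    holomorphic_map_on (inv_into D F) (F ` D)"

text \<open>Unlike \<^const>\<open>starlike\<close>, the centre is fixed to be the origin.\<close>

definition starlike_domain :: "'a::real_normed_vector set \<Rightarrow> bool"
  where "starlike_domain S \<longleftrightarrow>
    is_domain S \<and> 0 \<in> S \<and> (\<forall>w\<in>S. closed_segment 0 w \<subseteq> S)"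

definition starlike_mapping_on_ball ::
    "('a::complex_normed_vector \<Rightarrow> 'b::complex_normed_vector) \<Rightarrow> real \<Rightarrow> bool"
  where "starlike_mapping_on_ball F r \<longleftrightarrow>
    biholomorphic_map_on F (ball 0 r) \<and> starlike_domain (F ` ball 0 r)"

text \<open>On open subsets of the complex plane, holomorphy agrees with the library notion.\<close>

lemma holomorphic_map_on_complex_iff:
  fixes g :: "complex \<Rightarrow> complex"
  shows "holomorphic_map_on g D \<longleftrightarrow> open D \<and> g holomorphic_on D"
proof -
  have "(\<exists>L. (g has_derivative L) (at z) \<and> (\<forall>c h. L (c *\<^sub>C h) = c *\<^sub>C L h)) \<longleftrightarrow>
      g field_differentiable (at z)" (is "?l \<longleftrightarrow> ?r") for z
  proof
    assume ?l
    then obtain L where L: "(g has_derivative L) (at z)" "\<And>c h. L (c * h) = c * L h"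
      by (auto simp: scaleC_complex_def)
    have "L h = L 1 * h" for h
      using L(2)[of h 1] by (metis mult.right_neutral mult.commute)
    then have "L = (*) (L 1)"
      by (rule ext)
    with L(1) have "(g has_derivative (*) (L 1)) (at z)"
      by (rule subst[where P = "\<lambda>L. (g has_derivative L) (at z)", rotated])
    then show ?r
      unfolding field_differentiable_def has_field_derivative_def by blast
  next
    assume ?r
    then obtain d where "(g has_derivative (*) d) (at z)"
      unfolding field_differentiable_def has_field_derivative_def by blast
    then show ?l
      by (intro exI[of _ "(*) d"]) (auto simp: scaleC_complex_def)
  qed
  then show ?thesis
    unfolding holomorphic_map_on_def
    by (metis field_differentiable_at_within holomorphic_on_def holomorphic_on_imp_differentiable_at)
qed

end

theory Submission
  imports Defs
begin

text \<open>
  Everything is read off the one-variable slices \<open>s \<mapsto> s * f (s *\<^sub>C x)\<close>. The equation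
  \<open>f x *\<^sub>C x = y\<close> forces \<open>x = s *\<^sub>C y\<close> with \<open>s\<close> a root of \<open>s * f (s *\<^sub>C y) = 1\<close>, so
  injectivity and starlikeness pass between \<open>F\<close> and its slices. For injective slices, a root in a
  small disc persists when \<open>y\<close> is perturbed; hence \<open>F\<close> is open with continuous inverse, and
  no inverse function theorem in Banach spaces (nor continuity of the derivative) is needed. The
  derivative of \<open>F\<close> is a rank-one perturbation of a multiple of the identity, whose inverse is
  given by the Sherman-Morrison formula; the denominator is the slice derivative, which does not
  vanish because the slice is univalent.
\<close>

section \<open>Slices and complex scalar multiplication\<close>

definition slice :: "('a::complex_normed_vector \<Rightarrow> complex) \<Rightarrow> 'a \<Rightarrow> complex \<Rightarrow> complex"
  where "slice f x s = s * f (s *\<^sub>C x)"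

lemma bounded_bilinear_scaleC:
  "bounded_bilinear (scaleC :: complex \<Rightarrow> 'a::complex_normed_vector \<Rightarrow> 'a)"
proof
  show "\<exists>K. \<forall>a (b::'a). norm (a *\<^sub>C b) \<le> norm a * norm b * K"
    by (intro exI[of _ 1]) (simp add: norm_scaleC)
qed (simp_all add: scaleC_add_left scaleC_add_right scaleR_scaleC scaleC_scaleC
    scaleC_complex_def mult.commute)

lemmas scaleC_zero_left [simp] = bounded_bilinear.zero_left[OF bounded_bilinear_scaleC]
lemmas scaleC_zero_right [simp] = bounded_bilinear.zero_right[OF bounded_bilinear_scaleC]
lemmas scaleC_diff_left = bounded_bilinear.diff_left[OF bounded_bilinear_scaleC]
lemmas continuous_on_scaleC [continuous_intros] =
  bounded_bilinear.continuous_on[OF bounded_bilinear_scaleC]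
lemmas bounded_linear_scaleC_right = bounded_bilinear.bounded_linear_right[OF bounded_bilinear_scaleC]
lemmas bounded_linear_scaleC_left = bounded_bilinear.bounded_linear_left[OF bounded_bilinear_scaleC]
lemmas bounded_linear_const_scaleC = bounded_linear_compose[OF bounded_linear_scaleC_left]
lemmas has_derivative_scaleC = bounded_bilinear.FDERIV[OF bounded_bilinear_scaleC]

lemma scaleC_eq_0_iff [simp]:
  fixes x :: "'a::complex_normed_vector"
  shows "a *\<^sub>C x = 0 \<longleftrightarrow> a = 0 \<or> x = 0"
  by (metis norm_scaleC norm_eq_zero mult_eq_0_iff)

lemma scaleC_right_cancel:
  fixes x :: "'a::complex_normed_vector"
  shows "a *\<^sub>C x = b *\<^sub>C x \<longleftrightarrow> a = b \<or> x = 0"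
  using scaleC_eq_0_iff[of "a - b" x] by (simp add: scaleC_diff_left)

section \<open>Holomorphic maps, domains and biholomorphy\<close>

lemma holomorphic_map_onE:
  assumes "holomorphic_map_on F D" "x \<in> D"
  obtains L where "(F has_derivative L) (at x)" "\<And>c h. L (c *\<^sub>C h) = c *\<^sub>C L h"
  using assms unfolding holomorphic_map_on_def by metis

lemma holomorphic_map_on_subset:
  "holomorphic_map_on F D \<Longrightarrow> open E \<Longrightarrow> E \<subseteq> D \<Longrightarrow> holomorphic_map_on F E"
  unfolding holomorphic_map_on_def by blast

lemma holomorphic_map_on_imp_continuous_on:
  "holomorphic_map_on F D \<Longrightarrow> continuous_on D F"
  unfolding holomorphic_map_on_def
  by (meson continuous_at_imp_continuous_on has_derivative_continuous)

lemma is_domain_ball: "0 < r \<Longrightarrow> is_domain (ball (a::'a::real_normed_vector) r)"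
  unfolding is_domain_def by (simp add: convex_connected)

lemma is_domain_image:
  "is_domain D \<Longrightarrow> continuous_on D F \<Longrightarrow> open (F ` D) \<Longrightarrow> is_domain (F ` D)"
  unfolding is_domain_def by (auto intro: connected_continuous_image)

lemma biholomorphic_imp_is_domain_image:
  "biholomorphic_map_on F D \<Longrightarrow> is_domain (F ` D)"
  unfolding biholomorphic_map_on_def
  using is_domain_image holomorphic_map_on_imp_continuous_on by blast

text \<open>In one variable an injective holomorphic function has open image and holomorphic
  inverse, so univalence is all that has to be checked for a slice.\<close>

lemma biholomorphic_map_on_complexI:
  fixes g :: "complex \<Rightarrow> complex"
  assumes "is_domain D" "g holomorphic_on D" "inj_on g D"
  shows "biholomorphic_map_on g D"
proof -
  have D: "open D"
    using assms(1) by (simp add: is_domain_def)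
  obtain h where h: "h holomorphic_on g ` D" "\<And>z. z \<in> D \<Longrightarrow> h (g z) = z"
    using holomorphic_has_inverse[OF assms(2) D assms(3)] by metis
  have "inv_into D g holomorphic_on g ` D"
    by (rule holomorphic_transform[OF h(1)]) (auto simp: h(2) inv_into_f_f[OF assms(3)])
  then show ?thesis
    using assms D open_mapping_thm3[OF assms(2) D assms(3)]
    by (auto simp: biholomorphic_map_on_def holomorphic_map_on_complex_iff)
qed

section \<open>Derivative and injectivity of slices\<close>

text \<open>Chain and product rule; complex linearity of \<open>L\<close> turns the real derivative
  into multiplication by a number. The values used are \<open>f 0\<close> at \<open>s = 0\<close>
  and \<open>f x + L x\<close> at \<open>s = 1\<close>.\<close>

lemma slice_has_field_derivative:
  assumes "(f has_derivative L) (at (s *\<^sub>C x))" "\<And>c h. L (c *\<^sub>C h) = c *\<^sub>C L h"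
  shows "(slice f x has_field_derivative f (s *\<^sub>C x) + s * L x) (at s)"
proof -
  have "((\<lambda>s. s *\<^sub>C x) has_derivative (\<lambda>c. c *\<^sub>C x)) (at s)"
    by (rule bounded_linear_imp_has_derivative[OF bounded_linear_scaleC_left])
  then have "((\<lambda>s. f (s *\<^sub>C x)) has_derivative (\<lambda>c. L (c *\<^sub>C x))) (at s)"
    using has_derivative_compose assms(1) by blast
  then have "((\<lambda>s. s * f (s *\<^sub>C x)) has_derivative
      (\<lambda>c. s * L (c *\<^sub>C x) + c * f (s *\<^sub>C x))) (at s)"
    by (rule has_derivative_mult[OF has_derivative_ident])
  moreover have "(\<lambda>c. s * L (c *\<^sub>C x) + c * f (s *\<^sub>C x)) = (*) (f (s *\<^sub>C x) + s * L x)"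
    by (auto simp: assms(2) scaleC_complex_def algebra_simps)
  ultimately show ?thesis
    unfolding has_field_derivative_def slice_def[abs_def] by simp
qed

lemma open_slice_domain: "open {s. norm (s *\<^sub>C (x::'a::complex_normed_vector)) < r}"
  by (simp add: norm_scaleC) (intro open_Collect_less continuous_intros)

lemma slice_holomorphic:
  assumes "holomorphic_map_on f (ball 0 r)"
  shows "slice f x holomorphic_on {s. norm (s *\<^sub>C x) < r}"
proof -
  have "slice f x field_differentiable at s" if "norm (s *\<^sub>C x) < r" for s
    using assms that slice_has_field_derivative[of f _ s x]
    unfolding holomorphic_map_on_def field_differentiable_def by fastforce
  then show ?thesis
    by (auto simp: holomorphic_on_def intro: field_differentiable_at_within)
qed

lemma slice_domain_unit:
  "norm u = 1 \<Longrightarrow> {s. norm (s *\<^sub>C (u::'a::complex_normed_vector)) < r} = ball 0 r"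
  by (auto simp: norm_scaleC)

text \<open>For \<open>x \<noteq> 0\<close> the slice along \<open>x\<close> is a rescaled slice
  along \<open>x / norm x\<close>. For \<open>x = 0\<close> it is \<open>s * f 0\<close> on the
  whole plane, so the claim becomes \<open>f 0 \<noteq> 0\<close>, and some unit vector has to exist
  to supply this.\<close>

lemma slice_inj_if_unit_inj:
  fixes f :: "'a::complex_normed_vector \<Rightarrow> complex"
  assumes hol: "holomorphic_map_on f (ball 0 r)" and "0 < r"
    and ne: "sphere (0::'a) 1 \<noteq> {}"
    and inj: "\<And>u. norm u = 1 \<Longrightarrow> inj_on (slice f u) (ball 0 r)"
  shows "inj_on (slice f x) {s. norm (s *\<^sub>C x) < r}"
proof (cases "x = 0")
  case True
  obtain u :: 'a where u: "norm u = 1"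
    using ne by auto
  obtain L where L: "(f has_derivative L) (at 0)" "\<And>c h. L (c *\<^sub>C h) = c *\<^sub>C L h"
    using holomorphic_map_onE[OF hol, of 0] \<open>0 < r\<close> by auto
  have "slice f u holomorphic_on ball 0 r"
    using slice_holomorphic[OF hol, of u] u by (simp add: slice_domain_unit)
  \<comment> \<open>A univalent function has nonvanishing derivative, and here the derivative is
    \<open>f 0\<close>.\<close>
  then have "deriv (slice f u) 0 \<noteq> 0"
    using holomorphic_injective_imp_regular[OF _ open_ball inj[OF u]] \<open>0 < r\<close> by simp
  moreover have "deriv (slice f u) 0 = f 0"
    using slice_has_field_derivative[of f L 0 u] L by (simp add: DERIV_imp_deriv)
  ultimately show ?thesis
    by (auto simp: True slice_def inj_on_def)
next
  case False
  define u where "u = complex_of_real (1 / norm x) *\<^sub>C x"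
  have u: "norm u = 1"
    using False by (simp add: u_def norm_scaleC norm_divide)
  have xu: "s *\<^sub>C x = (s * norm x) *\<^sub>C u" for s
    using False by (simp add: u_def scaleC_scaleC)
  show ?thesis
  proof (rule inj_onI)
    fix s t
    assume st: "s \<in> {s. norm (s *\<^sub>C x) < r}" "t \<in> {s. norm (s *\<^sub>C x) < r}"
      and eq: "slice f x s = slice f x t"
    have "slice f u (s * norm x) = slice f u (t * norm x)"
      using eq by (simp add: slice_def xu)
    then have "s * norm x = t * norm x"
      by (rule inj_onD[OF inj[OF u]]) (use st in \<open>simp_all add: norm_scaleC norm_mult\<close>)
    then show "s = t"
      using False by simp
  qed
qed

text \<open>The slice takes the value 0 at 0 and the value \<open>f x\<close> at 1, and both points
  lie in its domain.\<close>

lemma inj_slices_nonzero: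
  assumes "inj_on (slice f x) {s. norm (s *\<^sub>C x) < r}" "0 < r" "norm x < r"
  shows "f x \<noteq> 0"
  using inj_onD[OF assms(1), of 0 1] assms(2,3) by (auto simp: slice_def scaleC_one)

section \<open>From injective slices to biholomorphy\<close>

text \<open>Since \<open>f\<close> has no zeros, points with equal images lie on one complex line,
  \<open>x = c *\<^sub>C y\<close>. Then \<open>slice f y\<close> takes the value \<open>f y\<close>
  at both \<open>c\<close> and 1.\<close>

lemma inj_slices_imp_inj_on:
  fixes f :: "'a::complex_normed_vector \<Rightarrow> complex"
  assumes inj: "\<And>x. inj_on (slice f x) {s. norm (s *\<^sub>C x) < r}" and "0 < r"
  shows "inj_on (\<lambda>x. f x *\<^sub>C x) (ball 0 r)"
proof (rule inj_onI)
  fix x y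
  assume "x \<in> ball 0 r" "y \<in> ball 0 r" and eq: "f x *\<^sub>C x = f y *\<^sub>C y"
  then have x: "norm x < r" and y: "norm y < r"
    by auto
  note nz = inj_slices_nonzero[OF inj \<open>0 < r\<close>]
  define c where "c = f y / f x"
  have "inverse (f x) *\<^sub>C f x *\<^sub>C x = inverse (f x) *\<^sub>C f y *\<^sub>C y"
    by (simp add: eq)
  then have xc: "x = c *\<^sub>C y"
    using nz[OF x] by (simp add: c_def scaleC_scaleC scaleC_one field_simps)
  then have "slice f y c = slice f y 1"
    using nz[OF x] by (simp add: slice_def scaleC_one flip: xc) (simp add: c_def)
  then have "c = 1"
    using inj_onD[OF inj] x y xc by (simp add: scaleC_one)
  then show "x = y"
    using xc by (simp add: scaleC_one)
qed

text \<open>A Rouche-type argument with parameter \<open>y\<close>: the root \<open>s0\<close> of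
  \<open>slice f y0 s = 1\<close> is unique, so the slice stays away from 1 on a small circle around
  \<open>s0\<close>. By compactness this persists for nearby \<open>y\<close>, which gives a root
  \<open>s\<close> in the disc and the preimage \<open>s *\<^sub>C y\<close> in
  \<open>V\<close>.\<close>

lemma inj_slices_locally_solvable:
  fixes f :: "'a::complex_normed_vector \<Rightarrow> complex"
  assumes hol: "holomorphic_map_on f (ball 0 r)" and "0 < r"
    and inj: "\<And>x. inj_on (slice f x) {s. norm (s *\<^sub>C x) < r}"
    and V: "open V" "x0 \<in> V" "V \<subseteq> ball 0 r"
  shows "\<exists>T. open T \<and> f x0 *\<^sub>C x0 \<in> T \<and> T \<subseteq> (\<lambda>x. f x *\<^sub>C x) ` V"
proof -
  have x0: "norm x0 < r"
    using V by auto
  have fx0: "f x0 \<noteq> 0"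
    by (rule inj_slices_nonzero[OF inj \<open>0 < r\<close> x0])
  define y0 where "y0 = f x0 *\<^sub>C x0"
  define s0 where "s0 = inverse (f x0)"
  have s0y0: "s0 *\<^sub>C y0 = x0"
    using fx0 by (simp add: s0_def y0_def scaleC_scaleC scaleC_one)
  have slice0: "slice f y0 s0 = 1"
    unfolding slice_def s0y0 using fx0 by (simp add: s0_def)
  \<comment> \<open>Pairs \<open>(y, s)\<close> whose candidate preimage
    \<open>s *\<^sub>C y\<close> lies in \<open>V\<close>.\<close>
  define \<Omega> where "\<Omega> = {p. snd p *\<^sub>C fst p \<in> V}"
  have "open \<Omega>"
    unfolding \<Omega>_def using open_vimage[OF V(1), of "\<lambda>p. snd p *\<^sub>C fst p"]
    by (simp add: vimage_def continuous_on_scaleC continuous_on_fst continuous_on_snd continuous_on_id)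
  have contf: "continuous_on V f"
    using holomorphic_map_on_imp_continuous_on[OF hol] V(3) continuous_on_subset by blast
  have contH: "continuous_on \<Omega> (\<lambda>p. slice f (fst p) (snd p))"
    unfolding slice_def
    by (intro continuous_intros continuous_on_compose2[OF contf]) (auto simp: \<Omega>_def)
  have "open {s. s *\<^sub>C y0 \<in> V}"
    using open_vimage[OF V(1), of "\<lambda>s. s *\<^sub>C y0"] by (simp add: vimage_def continuous_intros)
  moreover have "s0 \<in> {s. s *\<^sub>C y0 \<in> V}"
    using V(2) s0y0 by simp
  ultimately obtain e where e: "0 < e" "cball s0 e \<subseteq> {s. s *\<^sub>C y0 \<in> V}"
    using open_contains_cball by metis
  have "{y0} \<times> cball s0 e \<subseteq> \<Omega>"
    using e(2) by (auto simp: \<Omega>_def)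
  \<comment> \<open>Compactness of the disc makes the choice of \<open>A\<close> uniform in
    \<open>s\<close>.\<close>
  from Elementary_Topology.tube_lemma[OF compact_cball \<open>open \<Omega>\<close> this]
  obtain A where A: "y0 \<in> A" "open A" "A \<times> cball s0 e \<subseteq> \<Omega>"
    by blast
  \<comment> \<open>The pairs at which the value at the centre \<open>s0\<close> is strictly closer
    to 1 than the value at \<open>s\<close>; on the circle this is the inequality that forces a root
    inside.\<close>
  define W where "W = {p\<in>A \<times> UNIV \<inter> \<Omega>.
    norm (slice f (fst p) s0 - 1) < norm (slice f (fst p) (snd p) - 1)}"
  have "open W"
  proof -
    have op: "open (A \<times> UNIV \<inter> \<Omega>)"
      using A(2) \<open>open \<Omega>\<close> by (intro open_Int open_Times) auto
    have c1: "continuous_on (A \<times> UNIV \<inter> \<Omega>) (\<lambda>p. slice f (fst p) s0)"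
      using A(3) e(1)
      by (intro continuous_on_compose2[OF contH, of _ "\<lambda>p. (fst p, s0)", simplified]
          continuous_intros) auto
    have c2: "continuous_on (A \<times> UNIV \<inter> \<Omega>) (\<lambda>p. slice f (fst p) (snd p))"
      using contH continuous_on_subset by blast
    define g where "g = (\<lambda>p. norm (slice f (fst p) (snd p) - 1) - norm (slice f (fst p) s0 - 1))"
    have "continuous_on (A \<times> UNIV \<inter> \<Omega>) g"
      unfolding g_def by (intro continuous_intros c1 c2)
    then have "open ((A \<times> UNIV \<inter> \<Omega>) \<inter> g -` {0<..})"
      by (rule continuous_open_preimage[OF _ op open_greaterThan])
    moreover have "W = (A \<times> UNIV \<inter> \<Omega>) \<inter> g -` {0<..}"
      by (auto simp: W_def g_def)
    ultimately show ?thesis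
      by simp
  qed
  moreover have "{y0} \<times> sphere s0 e \<subseteq> W"
  proof -
    \<comment> \<open>For \<open>y0\<close> the value at the centre is exactly 1, so membership in
      \<open>W\<close> only asks that the value 1 is not taken on the circle.\<close>
    have "slice f y0 s \<noteq> 1" if "s \<in> sphere s0 e" for s
    proof
      assume "slice f y0 s = 1"
      moreover have "norm (s *\<^sub>C y0) < r"
        using that e(2) V(3) by (force simp: subset_iff)
      ultimately have "s = s0"
        using inj_onD[OF inj[of y0], of s s0] slice0 x0 s0y0 by simp
      with that e(1) show False
        by simp
    qed
    then show ?thesis
      using A e by (auto simp: W_def slice0 subset_iff)
  qed
  ultimately obtain B where B: "y0 \<in> B" "open B" "B \<times> sphere s0 e \<subseteq> W"
    using Elementary_Topology.tube_lemma[OF compact_sphere] by metis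
  have "y \<in> (\<lambda>x. f x *\<^sub>C x) ` V" if "y \<in> A \<inter> B" for y
  proof -
    have inV: "s *\<^sub>C y \<in> V" if "s \<in> cball s0 e" for s
    proof -
      have "(y, s) \<in> \<Omega>"
        using that \<open>y \<in> A \<inter> B\<close> A(3) by blast
      then show ?thesis
        by (simp add: \<Omega>_def)
    qed
    have "slice f y holomorphic_on cball s0 e"
      by (rule holomorphic_on_subset[OF slice_holomorphic[OF hol]]) (use inV V(3) in force)
    then have h: "(\<lambda>s. slice f y s - 1) holomorphic_on cball s0 e"
      by (intro holomorphic_intros)
    have "norm (slice f y s0 - 1) < norm (slice f y s - 1)" if "norm (s0 - s) = e" for s
    proof -
      have "(y, s) \<in> W"
        using B(3) that \<open>y \<in> A \<inter> B\<close> by (auto simp: subset_iff dist_norm)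
      then show ?thesis
        by (simp add: W_def)
    qed
    \<comment> \<open>Minimum modulus principle: a modulus smaller at the centre than everywhere on
      the circle forces a zero in the disc.\<close>
    then obtain s where s: "s \<in> ball s0 e" "slice f y s - 1 = 0"
      using holomorphic_contract_to_zero[OF holomorphic_on_imp_continuous_on[OF h]
          holomorphic_on_subset[OF h ball_subset_cball] e(1)] by metis
    then have "f (s *\<^sub>C y) *\<^sub>C s *\<^sub>C y = y"
      by (simp add: slice_def scaleC_scaleC scaleC_one mult.commute)
    then show ?thesis
      using inV[of s] s(1) by force
  qed
  then show ?thesis
    using A B by (intro exI[of _ "A \<inter> B"]) (auto simp: y0_def)
qed

text \<open>Local solvability makes \<open>F\<close> open, hence \<open>G\<close> continuous. A
  continuous inverse is differentiable wherever the derivative of \<open>F\<close> has a bounded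
  left inverse, and that left inverse is then its derivative.\<close>

lemma inj_slices_imp_biholomorphic:
  fixes f :: "'a::complex_normed_vector \<Rightarrow> complex"
  assumes hol: "holomorphic_map_on f (ball 0 r)" and "0 < r"
    and inj: "\<And>x. inj_on (slice f x) {s. norm (s *\<^sub>C x) < r}"
  shows "biholomorphic_map_on (\<lambda>x. f x *\<^sub>C x) (ball 0 r)"
proof -
  define F where "F = (\<lambda>x. f x *\<^sub>C x)"
  define G where "G = inv_into (ball 0 r) F"
  have injF: "inj_on F (ball 0 r)"
    unfolding F_def by (rule inj_slices_imp_inj_on[OF inj \<open>0 < r\<close>])
  have GF: "G (F x) = x" if "norm x < r" for x
    using that injF by (simp add: G_def)
  have openF: "open (F ` V)" if "open V" "V \<subseteq> ball 0 r" for V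
  proof (rule Topological_Spaces.openI)
    fix y
    assume "y \<in> F ` V"
    then show "\<exists>T. open T \<and> y \<in> T \<and> T \<subseteq> F ` V"
      using inj_slices_locally_solvable[OF hol \<open>0 < r\<close> inj that(1) _ that(2)]
      unfolding F_def by blast
  qed
  have "continuous_on (F ` ball 0 r) G"
  proof (rule continuous_on_open_gen[THEN iffD2, rule_format, of _ _ "ball 0 r"])
    show "G \<in> F ` ball 0 r \<rightarrow> ball 0 r"
      by (auto simp: GF)
  next
    fix U :: "'a set"
    assume U: "openin (top_of_set (ball 0 r)) U"
    then have sub: "U \<subseteq> ball 0 r" "open U"
      by (auto simp: openin_open_eq)
    \<comment> \<open>Preimages under \<open>G\<close> are images under \<open>F\<close>, so
      continuity of \<open>G\<close> is openness of \<open>F\<close>.\<close>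
    have "F ` ball 0 r \<inter> G -` U = F ` U"
      using sub(1) by (force simp: GF)
    then show "openin (top_of_set (F ` ball 0 r)) (F ` ball 0 r \<inter> G -` U)"
      using openF[OF sub(2,1)] sub(1) openF[OF open_ball order_refl]
      by (simp add: openin_open_eq image_mono)
  qed
  then have contG: "isCont G y" if "y \<in> F ` ball 0 r" for y
    using that openF[OF open_ball order_refl] continuous_on_eq_continuous_at by blast
  have der: "\<exists>L M. (F has_derivative L) (at x) \<and> (\<forall>c h. L (c *\<^sub>C h) = c *\<^sub>C L h) \<and>
      bounded_linear M \<and> M \<circ> L = id \<and> (\<forall>c h. M (c *\<^sub>C h) = c *\<^sub>C M h)"
    if x: "norm x < r" for x
  proof -
    obtain D where D: "(f has_derivative D) (at x)" "\<And>c h. D (c *\<^sub>C h) = c *\<^sub>C D h"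
      using holomorphic_map_onE[OF hol, of x] x by auto
    then interpret D: bounded_linear D
      by (simp add: has_derivative_bounded_linear)
    have Dmult: "D (c *\<^sub>C h) = c * D h" for c h
      by (simp add: D(2) scaleC_complex_def)
    have a: "f x \<noteq> 0"
      by (rule inj_slices_nonzero[OF inj \<open>0 < r\<close> x])
    \<comment> \<open>The derivative of \<open>slice f x\<close> at 1, nonzero by
      univalence.\<close>
    define b where "b = f x + D x"
    have "(slice f x has_field_derivative b) (at 1)"
      using slice_has_field_derivative[of f D 1 x] D by (simp add: scaleC_one b_def)
    moreover have "deriv (slice f x) 1 \<noteq> 0"
      by (rule holomorphic_injective_imp_regular[OF slice_holomorphic[OF hol]
            open_slice_domain inj]) (simp add: scaleC_one x)
    ultimately have b: "b \<noteq> 0"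
      by (simp add: DERIV_imp_deriv)
    define L where "L = (\<lambda>h. f x *\<^sub>C h + D h *\<^sub>C x)"
    \<comment> \<open>Sherman-Morrison inverse of \<open>L\<close>, which is \<open>f x\<close>
      times the identity plus the rank-one map \<open>h \<mapsto> D h *\<^sub>C x\<close>.\<close>
    define M where "M = (\<lambda>k. inverse (f x) *\<^sub>C k - (D k / (f x * b)) *\<^sub>C x)"
    have "(F has_derivative L) (at x)"
      unfolding F_def L_def by (rule has_derivative_scaleC[OF D(1) has_derivative_ident])
    moreover have "L (c *\<^sub>C h) = c *\<^sub>C L h" for c h
      by (simp add: L_def Dmult scaleC_add_right scaleC_scaleC mult.commute)
    moreover have "bounded_linear M"
      unfolding M_def
      by (intro bounded_linear_sub bounded_linear_scaleC_right bounded_linear_const_scaleC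
          bounded_linear_divide[THEN bounded_linear_compose] D.bounded_linear_axioms)
    moreover have "M (L h) = h" for h
    proof -
      \<comment> \<open>Thus the factor \<open>b\<close> cancels in the rank-one term of
        \<open>M (L h)\<close>.\<close>
      have "D (L h) = b * D h"
        by (simp add: L_def D.add Dmult b_def algebra_simps)
      then have "M (L h) = inverse (f x) *\<^sub>C L h - (D h / f x) *\<^sub>C x"
        using b by (simp add: M_def)
      also have "\<dots> = h"
        using a by (simp add: L_def scaleC_add_right scaleC_scaleC scaleC_one divide_inverse
            mult.commute)
      finally show ?thesis .
    qed
    moreover have "M (c *\<^sub>C h) = c *\<^sub>C M h" for c h
      by (simp add: M_def Dmult bounded_bilinear.diff_right[OF bounded_bilinear_scaleC]
          scaleC_scaleC mult.commute)
    ultimately show ?thesis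
      by (intro exI[of _ L] exI[of _ M]) (auto simp: fun_eq_iff)
  qed
  have "holomorphic_map_on F (ball 0 r)"
    unfolding holomorphic_map_on_def using der by (metis mem_ball_0 open_ball)
  moreover have "holomorphic_map_on G (F ` ball 0 r)"
    unfolding holomorphic_map_on_def
  proof (intro conjI ballI)
    show o: "open (F ` ball 0 r)"
      by (rule openF) auto
    fix y
    assume y: "y \<in> F ` ball 0 r"
    then obtain x where x: "norm x < r" "y = F x"
      by auto
    obtain L M where LM: "(F has_derivative L) (at x)" "bounded_linear M" "M \<circ> L = id"
      "\<forall>c h. M (c *\<^sub>C h) = c *\<^sub>C M h"
      using der[OF x(1)] by blast
    have "(G has_derivative M) (at y)"
    proof (rule has_derivative_inverse_basic[OF _ LM(2,3) contG[OF y] o y])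
      show "(F has_derivative L) (at (G y))"
        using LM(1) x GF by simp
      show "F (G z) = z" if "z \<in> F ` ball 0 r" for z
        using that by (auto simp: GF)
    qed
    with LM(4) show "\<exists>M. (G has_derivative M) (at y) \<and> (\<forall>c h. M (c *\<^sub>C h) = c *\<^sub>C M h)"
      by blast
  qed
  ultimately show ?thesis
    using injF openF[OF open_ball order_refl] is_domain_ball[OF \<open>0 < r\<close>]
    unfolding biholomorphic_map_on_def G_def F_def by blast
qed

section \<open>Starlikeness of the map and of its slices\<close>

text \<open>The endpoint \<open>t = 0\<close> of each segment is covered by \<open>F 0 = 0\<close>,
  so later arguments may assume \<open>t > 0\<close>.\<close>

lemma starlike_mapping_on_ballI:
  assumes bi: "biholomorphic_map_on F (ball 0 r)" and "0 < r" "F 0 = 0"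
    and star: "\<And>x t. norm x < r \<Longrightarrow> 0 < t \<Longrightarrow> t \<le> 1 \<Longrightarrow> t *\<^sub>R F x \<in> F ` ball 0 r"
  shows "starlike_mapping_on_ball F r"
proof -
  have "0 \<in> F ` ball 0 r"
    using assms(2,3) by force
  moreover have "t *\<^sub>R F x \<in> F ` ball 0 r" if "norm x < r" "0 \<le> t" "t \<le> 1" for x t
    using star[OF that(1), of t] that \<open>0 \<in> F ` ball 0 r\<close> by (cases "t = 0") auto
  ultimately show ?thesis
    using bi biholomorphic_imp_is_domain_image[OF bi]
    by (auto simp: starlike_mapping_on_ball_def starlike_domain_def closed_segment_def)
qed

lemma starlike_mapping_on_ballD:
  assumes "starlike_mapping_on_ball F r" "norm x < r" "0 \<le> t" "t \<le> 1"
  shows "\<exists>y. norm y < r \<and> F y = t *\<^sub>R F x"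
proof -
  have "closed_segment 0 (F x) \<subseteq> F ` ball 0 r"
    using assms(1,2) by (auto simp: starlike_mapping_on_ball_def starlike_domain_def)
  moreover have "t *\<^sub>R F x \<in> closed_segment 0 (F x)"
    using assms(3,4) by (auto simp: closed_segment_def)
  ultimately show ?thesis
    by force
qed

text \<open>On the line spanned by \<open>u\<close> the map acts as the slice. A preimage
  \<open>y\<close> of a nonzero point of this line lies on the line as well, since
  \<open>f y *\<^sub>C y\<close> is a multiple of \<open>y\<close>; starlikeness therefore restricts
  to the line.\<close>

lemma starlike_mapping_imp_slice:
  fixes f :: "'a::complex_normed_vector \<Rightarrow> complex"
  assumes hol: "holomorphic_map_on f (ball 0 r)" and "0 < r" and u: "norm u = 1"
    and star: "starlike_mapping_on_ball (\<lambda>x. f x *\<^sub>C x) r"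
  shows "starlike_mapping_on_ball (slice f u) r"
proof (rule starlike_mapping_on_ballI)
  have u0: "u \<noteq> 0"
    using u by auto
  have F: "f (s *\<^sub>C u) *\<^sub>C s *\<^sub>C u = slice f u s *\<^sub>C u" for s
    by (simp add: slice_def scaleC_scaleC mult.commute)
  have nu: "norm (s *\<^sub>C u) = norm s" for s
    by (simp add: norm_scaleC u)
  have "inj_on (\<lambda>x. f x *\<^sub>C x) (ball 0 r)"
    using star by (simp add: starlike_mapping_on_ball_def biholomorphic_map_on_def)
  then have "inj_on (slice f u) (ball 0 r)"
    unfolding inj_on_def using F nu scaleC_right_cancel u0
    by (smt (verit, best) dist_0_norm mem_ball)
  then show "biholomorphic_map_on (slice f u) (ball 0 r)"
    using slice_holomorphic[OF hol, of u] u \<open>0 < r\<close>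
    by (intro biholomorphic_map_on_complexI is_domain_ball) (auto simp: slice_domain_unit)
  show "0 < r" "slice f u 0 = 0"
    using \<open>0 < r\<close> by (auto simp: slice_def)
  fix s :: complex and t :: real
  assume s: "norm s < r" "0 < t" "t \<le> 1"
  obtain y where y: "norm y < r" "f y *\<^sub>C y = t *\<^sub>R slice f u s *\<^sub>C u"
    using starlike_mapping_on_ballD[OF star, of "s *\<^sub>C u" t] s by (auto simp: nu F)
  then have y2: "f y *\<^sub>C y = (t * slice f u s) *\<^sub>C u"
    by (simp add: scaleR_scaleC scaleC_scaleC)
  show "t *\<^sub>R slice f u s \<in> slice f u ` ball 0 r"
  proof (cases "slice f u s = 0")
    case True
    then show ?thesis
      using \<open>0 < r\<close> by (auto intro!: image_eqI[of _ _ 0] simp: slice_def)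
  next
    case False
    \<comment> \<open>Here \<open>t > 0\<close> matters: the target \<open>t * slice f u s\<close>
      must be nonzero before dividing by \<open>f y\<close>.\<close>
    then have "f y \<noteq> 0"
      using y2 u0 s(2) by auto
    define c where "c = t * slice f u s / f y"
    have "inverse (f y) *\<^sub>C f y *\<^sub>C y = c *\<^sub>C u"
      by (simp add: y2 scaleC_scaleC c_def field_simps)
    then have yc: "y = c *\<^sub>C u"
      using \<open>f y \<noteq> 0\<close> by (simp add: scaleC_scaleC scaleC_one)
    then have "slice f u c = t *\<^sub>R slice f u s"
      using y2 F[of c] u0 by (simp add: scaleC_right_cancel scaleR_conv_of_real)
    then show ?thesis
      using y(1) yc nu by (metis image_eqI mem_ball_0)
  qed
qed

text \<open>The segment from 0 to the image of \<open>x\<close> lies in the complex line through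
  \<open>x\<close>, where the map acts as the slice along \<open>x / norm x\<close>; starlikeness of
  that slice provides the preimages.\<close>

lemma slices_imp_starlike_mapping:
  fixes f :: "'a::complex_normed_vector \<Rightarrow> complex"
  assumes hol: "holomorphic_map_on f (ball 0 r)" and "0 < r"
    and ne: "sphere (0::'a) 1 \<noteq> {}"
    and star: "\<And>u. norm u = 1 \<Longrightarrow> starlike_mapping_on_ball (slice f u) r"
  shows "starlike_mapping_on_ball (\<lambda>x. f x *\<^sub>C x) r"
proof (rule starlike_mapping_on_ballI)
  have "inj_on (slice f u) (ball 0 r)" if "norm u = 1" for u
    using star[OF that] by (simp add: starlike_mapping_on_ball_def biholomorphic_map_on_def)
  then show "biholomorphic_map_on (\<lambda>x. f x *\<^sub>C x) (ball 0 r)"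
    by (intro inj_slices_imp_biholomorphic hol \<open>0 < r\<close> slice_inj_if_unit_inj ne)
  show "0 < r" "f 0 *\<^sub>C 0 = (0::'a)"
    using \<open>0 < r\<close> by auto
  fix x :: 'a and t :: real
  assume x: "norm x < r" "0 < t" "t \<le> 1"
  show "t *\<^sub>R f x *\<^sub>C x \<in> (\<lambda>x. f x *\<^sub>C x) ` ball 0 r"
  proof (cases "x = 0")
    case True
    then show ?thesis
      using \<open>0 < r\<close> by (auto intro!: image_eqI[of _ _ 0])
  next
    case False
    define u where "u = complex_of_real (1 / norm x) *\<^sub>C x"
    have u: "norm u = 1"
      using False by (simp add: u_def norm_scaleC norm_divide)
    have xu: "x = complex_of_real (norm x) *\<^sub>C u"
      using False by (simp add: u_def scaleC_scaleC scaleC_one)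
    obtain c where c: "norm c < r" "slice f u c = t *\<^sub>R slice f u (norm x)"
      using starlike_mapping_on_ballD[OF star[OF u], of "complex_of_real (norm x)" t] x by auto
    have "f (c *\<^sub>C u) *\<^sub>C c *\<^sub>C u = slice f u c *\<^sub>C u"
      by (simp add: slice_def scaleC_scaleC mult.commute)
    also have "\<dots> = (t * (norm x * f x)) *\<^sub>C u"
      unfolding c(2) by (simp add: slice_def scaleR_conv_of_real flip: xu)
    also have "\<dots> = t *\<^sub>R f x *\<^sub>C complex_of_real (norm x) *\<^sub>C u"
      by (simp add: scaleR_scaleC scaleC_scaleC mult.commute)
    also have "\<dots> = t *\<^sub>R f x *\<^sub>C x"
      by (simp flip: xu)
    finally show ?thesis
      using c(1) u by (intro image_eqI[of _ _ "c *\<^sub>C u"]) (auto simp: norm_scaleC)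
  qed
qed

text \<open>
  On the trivial space there is no unit vector, so the slices say nothing about \<open>f 0\<close>.
\<close>

lemma starlike_mapping_on_trivial_space:
  fixes F :: "'a::complex_normed_vector \<Rightarrow> 'a"
  assumes triv: "\<And>x::'a. x = 0" and "0 < r"
  shows "starlike_mapping_on_ball F r"
proof -
  have id: "G = id" for G :: "'a \<Rightarrow> 'a"
    using triv by (metis ext)
  have ball: "ball (0::'a) r = UNIV"
    using triv \<open>0 < r\<close> by (metis UNIV_eq_I centre_in_ball)
  have "holomorphic_map_on (id :: 'a \<Rightarrow> 'a) UNIV"
    unfolding holomorphic_map_on_def by (auto intro!: exI[of _ id] has_derivative_id simp: id_def)
  then have "biholomorphic_map_on F (ball 0 r)"
    using is_domain_ball[OF \<open>0 < r\<close>, of "0::'a"] id[of F] id[of "inv_into UNIV F"]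
    by (simp add: biholomorphic_map_on_def ball)
  then show ?thesis
  proof (rule starlike_mapping_on_ballI[OF _ \<open>0 < r\<close> triv])
    show "t *\<^sub>R F x \<in> F ` ball 0 r" for t x
      by (simp add: ball id[of F])
  qed
qed

theorem theorem3p2:
  fixes f :: "'a::cbanach \<Rightarrow> complex" and r :: real
  assumes "holomorphic_map_on f (ball 0 1)"
    and "0 < r" and "r < 1"
  shows "starlike_mapping_on_ball (\<lambda>x. f x *\<^sub>C x) r \<longleftrightarrow>
    (\<forall>u\<in>sphere 0 1. starlike_mapping_on_ball (\<lambda>\<zeta>. \<zeta> * f (\<zeta> *\<^sub>C u)) r)"
proof -
  have hol: "holomorphic_map_on f (ball 0 r)"
    using assms by (intro holomorphic_map_on_subset[OF assms(1)]) auto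
  have slice: "(\<lambda>\<zeta>. \<zeta> * f (\<zeta> *\<^sub>C u)) = slice f u" for u
    by (simp add: fun_eq_iff slice_def)
  show ?thesis
  \<comment> \<open>With an empty sphere the right-hand side holds vacuously, so starlikeness of the
    map has to be proved outright.\<close>
  proof (cases "sphere (0::'a) 1 = {}")
    case True
    have "x = 0" for x :: 'a
    proof (rule ccontr)
      assume "x \<noteq> 0"
      then have "x /\<^sub>R norm x \<in> sphere 0 1"
        by simp
      with True show False
        by blast
    qed
    from starlike_mapping_on_trivial_space[OF this \<open>0 < r\<close>] show ?thesis
      by (simp add: True)
  next
    case False
    show ?thesis
      unfolding slice
    proof (intro iffI ballI)
      fix u :: 'a
      assume "starlike_mapping_on_ball (\<lambda>x. f x *\<^sub>C x) r" "u \<in> sphere 0 1"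
      then show "starlike_mapping_on_ball (slice f u) r"
        using starlike_mapping_imp_slice[OF hol \<open>0 < r\<close>] by simp
    next
      assume "\<forall>u\<in>sphere 0 1. starlike_mapping_on_ball (slice f u) r"
      then show "starlike_mapping_on_ball (\<lambda>x. f x *\<^sub>C x) r"
        using slices_imp_starlike_mapping[OF hol \<open>0 < r\<close> False] by simp
    qed
  qed
qed

end
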